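(* For any integers $n\geq i\geq 0$, there holds $$V_{n,i}=U_{n,i}-U_{n-1,i},\qquad D_{n,i}=U_{n,i}.$$
   Context: A G-Motzkin path of length $n$ is a lattice path from $(0,0)$ to $(n,0)$ in the first quadrant (never going below the $x$-axis) consisting of up steps $\mathbf{u}=(1,1)$, down steps $\mathbf{d}=(1,-1)$, horizontal steps $\mathbf{h}=(1,0)$ and vertical steps $\mathbf{v}=(0,-1)$. It is $\mathbf{uvu}$-avoiding if it contains no three consecutive steps $\mathbf{u},\mathbf{v},\mathbf{u}$. $\mathcal{G}_{n}^{\mathbf{uvu}}$ is the set of all (unweighted) $\mathbf{uvu}$-avoiding G-Motzkin paths of length $n$. A step is at level $\ell$ if the ordinate of its endpoint is $\ell$. $U_{n,i}$ is the total number of $\mathbf{u}$-steps at level $i+1$ in all paths $\mathbf{G}\in\mathcal{G}_{n+1}^{\mathbf{uvu}}$ (in particular $U_{n-1,i}=0$ when $n=i$). $V_{n,i}$ is the total number of $\mathbf{v}$-steps at level $i$ in all paths $\mathbf{G}\in\mathcal{G}_{n+1}^{\mathbf{uvu}}$. $D_{n,i}$ is the total number of $\mathbf{d}$-steps at level $i$ in all paths $\mathbf{G}\in\mathcal{G}_{n+2}^{\mathbf{uvu}}$. *)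

theory Defs
  imports Main "HOL-Library.Sublist" "HOL-Library.Product_Plus"
begin

datatype step = Up | Down | Horizontal | Vertical

fun step_vec :: "step \<Rightarrow> int \<times> int" where
  "step_vec Up = (1, 1)"
| "step_vec Down = (1, -1)"
| "step_vec Horizontal = (1, 0)"
| "step_vec Vertical = (0, -1)"

text \<open>A lattice path starting at the origin is represented by its list of steps.\<close>

definition endpoint :: "step list \<Rightarrow> int \<times> int" where
  "endpoint p = (\<Sum>s\<leftarrow>p. step_vec s)"

definition in_first_quadrant :: "step list \<Rightarrow> bool" where
  "in_first_quadrant p \<longleftrightarrow>
     (\<forall>j\<le>length p. 0 \<le> fst (endpoint (take j p)) \<and> 0 \<le> snd (endpoint (take j p)))"

text \<open>The length of a path is the abscissa of its endpoint, not its number of steps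
  (vertical steps do not contribute).\<close>

definition G_Motzkin_paths :: "int \<Rightarrow> step list set" where
  "G_Motzkin_paths n = {p. in_first_quadrant p \<and> endpoint p = (n, 0)}"

definition uvu_avoiding :: "step list \<Rightarrow> bool" where
  "uvu_avoiding p \<longleftrightarrow> \<not> sublist [Up, Vertical, Up] p"

definition G_uvu :: "int \<Rightarrow> step list set" where
  "G_uvu n = {p \<in> G_Motzkin_paths n. uvu_avoiding p}"

definition steps_at_level :: "step \<Rightarrow> int \<Rightarrow> step list \<Rightarrow> nat" where
  "steps_at_level s l p =
     card {j. j < length p \<and> p ! j = s \<and> snd (endpoint (take (Suc j) p)) = l}"

text \<open>The indices are integers, so that \<open>U_count (n - 1) i\<close> is a count over paths of
  length \<open>n\<close> also for \<open>n = 0\<close>.\<close>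

definition U_count :: "int \<Rightarrow> int \<Rightarrow> nat" where
  "U_count n i = (\<Sum>p\<in>G_uvu (n + 1). steps_at_level Up (i + 1) p)"

definition V_count :: "int \<Rightarrow> int \<Rightarrow> nat" where
  "V_count n i = (\<Sum>p\<in>G_uvu (n + 1). steps_at_level Vertical i p)"

definition D_count :: "int \<Rightarrow> int \<Rightarrow> nat" where
  "D_count n i = (\<Sum>p\<in>G_uvu (n + 2). steps_at_level Down i p)"

text \<open>The sets summed over are finite, so none of these sums is degenerate.\<close>

lemma length_le_endpoint: "int (length p) \<le> 2 * fst (endpoint p) - snd (endpoint p)"
proof (induction p)
  case Nil
  then show ?case by (simp add: endpoint_def)
next
  case (Cons s p)
  then show ?case by (cases s) (auto simp: endpoint_def)
qed

lemma finite_G_uvu: "finite (G_uvu n)"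
proof (rule finite_subset)
  show "G_uvu n \<subseteq> {p. set p \<subseteq> {Up, Down, Horizontal, Vertical} \<and> length p \<le> nat (2 * n)}"
  proof
    fix p assume "p \<in> G_uvu n"
    then have "endpoint p = (n, 0)" by (simp add: G_uvu_def G_Motzkin_paths_def)
    then have "int (length p) \<le> 2 * n" using length_le_endpoint[of p] by simp
    moreover have "s \<in> {Up, Down, Horizontal, Vertical}" for s by (cases s) auto
    ultimately show "p \<in> {p. set p \<subseteq> {Up, Down, Horizontal, Vertical} \<and> length p \<le> nat (2 * n)}"
      by auto
  qed
  show "finite {p. set p \<subseteq> {Up, Down, Horizontal, Vertical} \<and> length p \<le> nat (2 * n)}"
    by (rule finite_lists_length_le) simp
qed

end

theory Submission imports Defs begin

text \<open>
  Write \<open>U n\<close>, \<open>V n\<close>, \<open>D n\<close> for the three counts at a fixed \<open>i \<ge> 0\<close>. Two relations between them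
  suffice.

  First, every path crosses between heights \<open>i\<close> and \<open>i + 1\<close> equally often in both directions,
  and a crossing back is a down step or a vertical step. As \<open>U n\<close>, \<open>V n\<close> and \<open>D (n - 1)\<close> all
  refer to paths of length \<open>n + 1\<close>, this gives \<open>U n = V n + D (n - 1)\<close>
  (\<open>U_count_eq_V_count_plus_D_count\<close>).

  Secondly, turn a marked vertical step into a marked down step, which lengthens the path by one.
  This always preserves avoidance of \<open>uvu\<close>, because a down step lies in no occurrence of
  \<open>uvu\<close>. Conversely, a marked \<open>d\<close> in an avoiding path may be turned into \<open>v\<close> unless it is the
  middle of \<open>u d u\<close>. Such a \<open>u d u\<close> can be contracted to a single marked \<open>u\<close>, which ends at
  level \<open>i + 1\<close> and shortens the path by two; each marked \<open>u\<close> arises exactly once. So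
  \<open>D n = V n + U (n - 1)\<close> (\<open>D_count_eq_V_count_plus_U_count\<close>).

  Eliminating \<open>V\<close> yields \<open>D n - U n = -(D (n - 1) - U (n - 1))\<close>. Since both counts vanish for
  \<open>n = -2\<close>, induction gives \<open>D = U\<close>, and the second relation then becomes the formula for \<open>V\<close>.
\<close>

section \<open>Concatenation of paths\<close>

lemma endpoint_Nil [simp]: "endpoint [] = 0"
  by (simp add: endpoint_def)

lemma endpoint_Cons [simp]: "endpoint (s # p) = step_vec s + endpoint p"
  by (simp add: endpoint_def)

lemma endpoint_append [simp]: "endpoint (p @ q) = endpoint p + endpoint q"
  by (simp add: endpoint_def)

lemma fst_step_vec_nonneg: "0 \<le> fst (step_vec s)"
  by (cases s) auto

lemma fst_endpoint_nonneg: "0 \<le> fst (endpoint p)"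
  by (induction p) (auto simp: fst_step_vec_nonneg)

text \<open>Starting from an arbitrary height makes the quadrant condition compositional.\<close>

fun nonneg_from :: "int \<Rightarrow> step list \<Rightarrow> bool" where
  "nonneg_from h [] \<longleftrightarrow> 0 \<le> h"
| "nonneg_from h (s # p) \<longleftrightarrow> 0 \<le> h \<and> nonneg_from (h + snd (step_vec s)) p"

lemma nonneg_from_start: "nonneg_from h p \<Longrightarrow> 0 \<le> h"
  by (cases p) auto

lemma nonneg_from_end: "nonneg_from h p \<Longrightarrow> 0 \<le> h + snd (endpoint p)"
  by (induction p arbitrary: h) (fastforce simp: algebra_simps)+

lemma nonneg_from_append:
  "nonneg_from h (p @ q) \<longleftrightarrow> nonneg_from h p \<and> nonneg_from (h + snd (endpoint p)) q"
  by (induction p arbitrary: h) (auto simp: algebra_simps dest: nonneg_from_start)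

lemma nonneg_from_iff_take:
  "nonneg_from h p \<longleftrightarrow> (\<forall>j\<le>length p. 0 \<le> h + snd (endpoint (take j p)))"
proof (induction p arbitrary: h)
  case Nil
  then show ?case by simp
next
  case (Cons s p)
  show ?case
    by (simp add: Cons.IH All_less_Suc2 add.assoc flip: less_Suc_eq_le)
qed

lemma in_first_quadrant_iff: "in_first_quadrant p \<longleftrightarrow> nonneg_from 0 p"
  by (simp add: in_first_quadrant_def nonneg_from_iff_take fst_endpoint_nonneg)

lemma mem_G_uvu_iff:
  "p \<in> G_uvu n \<longleftrightarrow> nonneg_from 0 p \<and> endpoint p = (n, 0) \<and> uvu_avoiding p"
  by (auto simp: G_uvu_def G_Motzkin_paths_def in_first_quadrant_iff)

section \<open>Avoidance at a split point\<close>

lemma append_eq_triple_iff: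
  "[a, b, c] = xs @ ys \<longleftrightarrow>
     xs = [] \<and> ys = [a, b, c] \<or> xs = [a] \<and> ys = [b, c] \<or>
     xs = [a, b] \<and> ys = [c] \<or> xs = [a, b, c] \<and> ys = []"
  by (auto simp: Cons_eq_append_conv)

lemma uvu_avoiding_append:
  "uvu_avoiding (p @ q) \<longleftrightarrow>
     uvu_avoiding p \<and> uvu_avoiding q \<and>
     \<not> (suffix [Up] p \<and> prefix [Vertical, Up] q) \<and>
     \<not> (suffix [Up, Vertical] p \<and> prefix [Up] q)"
  unfolding uvu_avoiding_def sublist_append append_eq_triple_iff
  by (auto dest: suffix_imp_sublist prefix_imp_sublist)

lemma uvu_avoiding_Nil [simp]: "uvu_avoiding []"
  by (simp add: uvu_avoiding_def)

lemma uvu_avoiding_Cons: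
  "uvu_avoiding (s # q) \<longleftrightarrow> uvu_avoiding q \<and> \<not> (s = Up \<and> prefix [Vertical, Up] q)"
  by (auto simp: uvu_avoiding_def sublist_Cons_right)

lemma uvu_avoiding_split_Down:
  "uvu_avoiding (p @ Down # q) \<longleftrightarrow> uvu_avoiding p \<and> uvu_avoiding q"
  by (auto simp: uvu_avoiding_append uvu_avoiding_Cons)

lemma uvu_avoiding_split_Vertical:
  "uvu_avoiding (p @ Vertical # q) \<longleftrightarrow>
     uvu_avoiding p \<and> uvu_avoiding q \<and> \<not> (suffix [Up] p \<and> prefix [Up] q)"
  by (auto simp: uvu_avoiding_append uvu_avoiding_Cons)

text \<open>An up step may be doubled when the path is cut there: an occurrence of \<open>uvu\<close> has no up
  step in its middle, so it cannot extend to both sides of the cut.\<close>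

lemma uvu_avoiding_split_Up:
  "uvu_avoiding (p @ Up # q) \<longleftrightarrow> uvu_avoiding (p @ [Up]) \<and> uvu_avoiding (Up # q)"
  by (auto simp: uvu_avoiding_append uvu_avoiding_Cons)

section \<open>Crossings of a level\<close>

lemma steps_at_level_Nil [simp]: "steps_at_level s l [] = 0"
  by (simp add: steps_at_level_def)

lemma steps_at_level_snoc:
  "steps_at_level s l (p @ [t]) =
     steps_at_level s l p + (if t = s \<and> snd (endpoint (p @ [t])) = l then 1 else 0)"
proof -
  let ?A = "{j. j < length p \<and> p ! j = s \<and> snd (endpoint (take (Suc j) p)) = l}"
  let ?B = "{j. j < length (p @ [t]) \<and> (p @ [t]) ! j = s \<and>
               snd (endpoint (take (Suc j) (p @ [t]))) = l}"
  have "?B = ?A \<union> (if t = s \<and> snd (endpoint (p @ [t])) = l then {length p} else {})"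
    by (auto simp: nth_append less_Suc_eq)
  moreover have "finite ?A" by simp
  moreover have "length p \<notin> ?A" by simp
  ultimately show ?thesis
    unfolding steps_at_level_def by (auto simp del: endpoint_append)
qed

text \<open>Every step changes the height by at most one, so a path from height \<open>0 \<le> l\<close> lies above
  \<open>l\<close> at its end exactly if it has crossed upwards once more than downwards.\<close>

lemma crossings_balance:
  assumes "0 \<le> l"
  shows "int (steps_at_level Up (l + 1) p) =
           int (steps_at_level Down l p) + int (steps_at_level Vertical l p) +
           (if l < snd (endpoint p) then 1 else 0)"
proof (induction p rule: rev_induct)
  case Nil
  then show ?case using assms by simp
next
  case (snoc s p)
  then show ?case by (cases s) (auto simp: steps_at_level_snoc)
qed

lemma U_count_eq_V_count_plus_D_count:
  assumes "0 \<le> i"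
  shows "U_count n i = V_count n i + D_count (n - 1) i"
proof -
  have "steps_at_level Up (i + 1) p = steps_at_level Vertical i p + steps_at_level Down i p"
    if "p \<in> G_uvu (n + 1)" for p
    using crossings_balance[OF assms, of p] that assms by (simp add: mem_G_uvu_iff)
  then show ?thesis
    by (simp add: U_count_def V_count_def D_count_def sum.distrib add.commute[of 1])
qed

section \<open>Paths with a marked step\<close>

text \<open>A path with a marked step is kept as the pair of its parts before and after that step, so
  that replacing the marked step does not change the pair.\<close>

definition marked :: "step \<Rightarrow> int \<Rightarrow> int \<Rightarrow> (step list \<times> step list) set" where
  "marked s l n =
     {(xs, ys). xs @ s # ys \<in> G_uvu n \<and> snd (endpoint (xs @ [s])) = l}"

lemma steps_at_level_eq_card_splits:
  "steps_at_level s l p =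
     card {(xs, ys). xs @ s # ys = p \<and> snd (endpoint (xs @ [s])) = l}"
  (is "_ = card ?S")
proof -
  let ?J = "{j. j < length p \<and> p ! j = s \<and> snd (endpoint (take (Suc j) p)) = l}"
  have "bij_betw (\<lambda>j. (take j p, drop (Suc j) p)) ?J ?S"
    by (rule bij_betw_byWitness[where f' = "\<lambda>(xs, ys). length xs"])
      (auto simp: id_take_nth_drop[symmetric] take_Suc_conv_app_nth)
  then show ?thesis
    unfolding steps_at_level_def by (rule bij_betw_same_card)
qed

lemma sum_steps_at_level:
  "(\<Sum>p\<in>G_uvu n. steps_at_level s l p) = card (marked s l n)"
proof -
  let ?S = "\<lambda>p. {(xs, ys). xs @ s # ys = p \<and> snd (endpoint (xs @ [s])) = l}"
  have fin: "finite (?S p)" for p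
  proof (rule finite_subset)
    show "?S p \<subseteq> set (prefixes p) \<times> set (suffixes p)"
      by (auto simp: suffix_def)
  qed simp
  have "marked s l n = (\<Union>p\<in>G_uvu n. ?S p)"
    by (auto simp: marked_def)
  also have "card \<dots> = (\<Sum>p\<in>G_uvu n. card (?S p))"
    using fin by (intro card_UN_disjoint finite_G_uvu) auto
  finally show ?thesis
    by (simp add: steps_at_level_eq_card_splits)
qed

lemma finite_marked: "finite (marked s l n)"
proof (rule finite_imageD)
  show "finite ((\<lambda>(xs, ys). (xs @ s # ys, length xs)) ` marked s l n)"
  proof (rule finite_subset)
    show "(\<lambda>(xs, ys). (xs @ s # ys, length xs)) ` marked s l n
            \<subseteq> (\<Union>p\<in>G_uvu n. {p} \<times> {..length p})"
      by (auto simp: marked_def)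
  qed (simp add: finite_G_uvu)
  show "inj_on (\<lambda>(xs, ys). (xs @ s # ys, length xs)) (marked s l n)"
    by (auto simp: inj_on_def)
qed

lemma marked_Vertical_iff:
  "(xs, ys) \<in> marked Vertical i (n + 1) \<longleftrightarrow>
     (xs, ys) \<in> marked Down i (n + 2) \<and> \<not> (suffix [Up] xs \<and> prefix [Up] ys)"
  by (auto simp: marked_def mem_G_uvu_iff nonneg_from_append prod_eq_iff
      uvu_avoiding_split_Down uvu_avoiding_split_Vertical)

text \<open>Contracting \<open>u d u\<close> to \<open>u\<close> is reversible. Expanding \<open>u\<close> visits the height \<open>i\<close> once
  more, after the down step; it is nonnegative because it is also the height at the end of \<open>xs\<close>.\<close>

lemma marked_Down_between_Ups_iff:
  "(xs @ [Up], Up # ys) \<in> marked Down i (n + 2) \<longleftrightarrow> (xs, ys) \<in> marked Up (i + 1) n"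
  using uvu_avoiding_split_Up[of xs ys] nonneg_from_end[of 0 xs]
  by (auto simp: marked_def mem_G_uvu_iff nonneg_from_append prod_eq_iff
      uvu_avoiding_split_Down[of "xs @ [Up]" "Up # ys", simplified] algebra_simps)

lemma marked_Down_eq:
  "marked Down i (n + 2) =
     marked Vertical i (n + 1) \<union> (\<lambda>(xs, ys). (xs @ [Up], Up # ys)) ` marked Up (i + 1) n"
  (is "?D = ?V \<union> ?f ` ?U")
proof (rule set_eqI, clarify)
  fix xs ys
  have "(xs, ys) \<in> ?f ` ?U \<longleftrightarrow> (xs, ys) \<in> ?D \<and> suffix [Up] xs \<and> prefix [Up] ys"
    by (force simp: suffix_def prefix_def marked_Down_between_Ups_iff)
  then show "(xs, ys) \<in> ?D \<longleftrightarrow> (xs, ys) \<in> ?V \<union> ?f ` ?U"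
    by (auto simp: marked_Vertical_iff)
qed

lemma D_count_eq_V_count_plus_U_count: "D_count n i = V_count n i + U_count (n - 1) i"
proof -
  let ?f = "\<lambda>(xs, ys). (xs @ [Up], Up # ys)"
  have "card (marked Down i (n + 2)) =
          card (marked Vertical i (n + 1)) + card (?f ` marked Up (i + 1) n)"
    unfolding marked_Down_eq
    by (intro card_Un_disjoint finite_imageI finite_marked) (auto simp: marked_Vertical_iff)
  also have "card (?f ` marked Up (i + 1) n) = card (marked Up (i + 1) n)"
    by (intro card_image) (auto simp: inj_on_def)
  finally show ?thesis
    by (simp add: D_count_def V_count_def U_count_def sum_steps_at_level)
qed

section \<open>The two identities\<close>

lemma G_uvu_neg:
  assumes "n < 0"
  shows "G_uvu n = {}"
proof (rule equals0I)
  fix p assume "p \<in> G_uvu n"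
  then show False
    using assms fst_endpoint_nonneg[of p] by (simp add: mem_G_uvu_iff)
qed

text \<open>The induction starts at \<open>n = -2\<close>, where the up steps are counted over no path and the
  down steps over the empty path only.\<close>

lemma D_count_eq_U_count:
  assumes "0 \<le> i" and "-2 \<le> n"
  shows "D_count n i = U_count n i"
  using assms(2)
proof (induction n rule: int_ge_induct)
  case base
  have "steps_at_level Down i p = 0" if "p \<in> G_uvu 0" for p
    using length_le_endpoint[of p] that by (simp add: mem_G_uvu_iff)
  then have "D_count (-2) i = 0"
    by (simp add: D_count_def)
  then show ?case
    by (simp add: U_count_def G_uvu_neg)
next
  case (step n)
  then show ?case
    using U_count_eq_V_count_plus_D_count[OF assms(1), of "n + 1"]
      D_count_eq_V_count_plus_U_count[of "n + 1" i]
    by simp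
qed

theorem theorem4p3:
  fixes n i :: int
  assumes "n \<ge> i" and "i \<ge> 0"
  shows "int (V_count n i) = int (U_count n i) - int (U_count (n - 1) i) \<and>
         D_count n i = U_count n i"
  using assms D_count_eq_U_count[of i n] D_count_eq_V_count_plus_U_count[of n i] by simp

end
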